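(* Every minimum edge cut in a plane triangulation is trivial.
   Context: A plane triangulation is a planar realization of the graph of a simplicial $3$-polytope (a $3$-dimensional convex polytope all of whose proper faces are simplices); equivalently, for graphs with $v \ge 4$ vertices, it is a simple plane graph with exactly $3v-6$ edges. For a connected graph $G$ with vertex set $V$, an edge cut is a set $\mathcal{E}(V_\circ, V_\bullet)$ consisting of all edges with one endpoint in $V_\circ$ and the other in $V_\bullet$, for some partition $V = V_\circ \sqcup V_\bullet$ with $V_\circ \neq \varnothing \neq V_\bullet$. A minimum edge cut is an edge cut of minimal cardinality among all edge cuts of $G$. An edge cut is trivial if it is the set of all edges incident to some given vertex. *)

theory Defs
  imports "HOL-Analysis.Analysis"
begin

text \<open>
  The plane is the type \<^typ>\<open>complex\<close>. A plane graph is a finite set \<open>V\<close> of points together with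
  a finite set \<open>E\<close> of arcs, each given by its point set. An arc of \<open>E\<close> meets \<open>V\<close> exactly in its two
  (distinct) endpoints, so \<open>e \<inter> V\<close> is the set of endpoints of the edge \<open>e\<close>, and a vertex \<open>v \<in> V\<close> is
  incident to \<open>e\<close> iff \<open>v \<in> e\<close>. The last conjunct says that distinct edges meet only in vertices
  and that there are no parallel edges; loops are excluded because an arc has distinct endpoints.
\<close>

definition simple_plane_graph :: "complex set \<Rightarrow> complex set set \<Rightarrow> bool" where
  "simple_plane_graph V E \<longleftrightarrow>
     finite V \<and> finite E \<and>
     (\<forall>e\<in>E. \<exists>g. arc g \<and> path_image g = e \<and> e \<inter> V = {pathstart g, pathfinish g}) \<and>
     (\<forall>e\<in>E. \<forall>f\<in>E. e \<noteq> f \<longrightarrow> e \<inter> f \<subseteq> V \<and> e \<inter> V \<noteq> f \<inter> V)"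

definition simplicial_3_polytope :: "(real^3) set \<Rightarrow> bool" where
  "simplicial_3_polytope P \<longleftrightarrow>
     polytope P \<and> aff_dim P = 3 \<and> (\<forall>F. F face_of P \<and> F \<noteq> P \<longrightarrow> (\<exists>n. n simplex F))"

text \<open>
  The graph of a polytope has the extreme points as its vertices, two of them being adjacent iff
  the segment joining them is a one-dimensional face. A realization is a graph isomorphism \<open>\<phi>\<close>.
\<close>

definition realizes_polytope_graph :: "complex set \<Rightarrow> complex set set \<Rightarrow> (real^3) set \<Rightarrow> bool" where
  "realizes_polytope_graph V E P \<longleftrightarrow>
     (\<exists>\<phi>. bij_betw \<phi> V {x. x extreme_point_of P} \<and>
          (\<forall>u\<in>V. \<forall>v\<in>V. (\<exists>e\<in>E. e \<inter> V = {u, v}) \<longleftrightarrow> closed_segment (\<phi> u) (\<phi> v) edge_of P))"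

definition plane_triangulation :: "complex set \<Rightarrow> complex set set \<Rightarrow> bool" where
  "plane_triangulation V E \<longleftrightarrow>
     simple_plane_graph V E \<and> (\<exists>P. simplicial_3_polytope P \<and> realizes_polytope_graph V E P)"

definition edges_between ::
    "complex set \<Rightarrow> complex set set \<Rightarrow> complex set \<Rightarrow> complex set \<Rightarrow> complex set set" where
  "edges_between V E A B = {e \<in> E. \<exists>a\<in>A. \<exists>b\<in>B. e \<inter> V = {a, b}}"

definition edge_cut :: "complex set \<Rightarrow> complex set set \<Rightarrow> complex set set \<Rightarrow> bool" where
  "edge_cut V E C \<longleftrightarrow>
     (\<exists>A B. A \<union> B = V \<and> A \<inter> B = {} \<and> A \<noteq> {} \<and> B \<noteq> {} \<and> C = edges_between V E A B)"

definition minimum_edge_cut :: "complex set \<Rightarrow> complex set set \<Rightarrow> complex set set \<Rightarrow> bool" where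
  "minimum_edge_cut V E C \<longleftrightarrow> edge_cut V E C \<and> (\<forall>D. edge_cut V E D \<longrightarrow> card C \<le> card D)"

definition trivial_edge_cut :: "complex set \<Rightarrow> complex set set \<Rightarrow> complex set set \<Rightarrow> bool" where
  "trivial_edge_cut V E C \<longleftrightarrow> edge_cut V E C \<and> (\<exists>v\<in>V. C = {e \<in> E. v \<in> e})"

end

theory Submission
  imports Defs
begin

text \<open>
  The proof is edge counting. It needs two facts about the graph on \<open>n\<close> vertices: it has exactly
  \<open>3 n - 6\<close> edges, and every set of \<open>a \<ge> 3\<close> vertices spans at most \<open>3 a - 6\<close> edges. Given these, let
  \<open>k\<close> be the size of a minimum edge cut, with sides of sizes \<open>a\<close> and \<open>b\<close>. Since the degree sum is
  \<open>6 n - 12\<close>, some vertex has degree at most 5, and its edges form a cut, so \<open>k \<le> 5\<close>. If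
  \<open>a, b \<ge> 3\<close>, then at least \<open>(3 n - 6) - (3 a - 6) - (3 b - 6) = 6\<close> edges cross, which is too many. If
  one side is a pair \<open>{u, w}\<close>, then \<open>deg u + deg w \<le> k + 2\<close>; but both degrees are at least \<open>k\<close>, and all
  degrees are at least 3, because deleting a vertex leaves at most \<open>3 (n - 1) - 6\<close> edges. So one side
  is a single vertex. This is \<open>min_cut_trivial_graph\<close>.

  Both facts are read off from the polytope \<open>P\<close> that the triangulation realizes; the drawing
  contributes that the graph is simple. The second fact follows from the case of a whole
  polytope: for a set \<open>A\<close> of vertices of \<open>P\<close>, all edges of \<open>P\<close> with both ends in \<open>A\<close> are edges of
  \<open>convex hull A\<close>, so it is enough that a three-dimensional polytope with \<open>a\<close> vertices has at most
  \<open>3 a - 6\<close> edges, and that a polygon has as many edges as vertices.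

  What remains is Euler's formula in dimension three, which is proved by sweeping a plane across
  the polytope. Choose a linear functional \<open>c\<close> that separates the vertices. A facet with
  \<open>n\<^sub>F\<close> vertices has \<open>n\<^sub>F - 2\<close> vertices that are neither lowest nor highest in it. Conversely, a
  vertex \<open>v\<close> that is neither lowest nor highest in \<open>P\<close> lies strictly between the bottom and the top
  of exactly two facets: the plane at its level cuts \<open>P\<close> in a polygon with \<open>v\<close> as a vertex, the
  facets in question are cut in the edges of that polygon at \<open>v\<close>, and there are two of them. Counting
  pairs gives \<open>\<Sum>\<^sub>F (n\<^sub>F - 2) = 2 (n - 2)\<close>. Every edge lies in two facets, so also \<open>\<Sum>\<^sub>F n\<^sub>F = 2 e\<close>; with
  \<open>n\<^sub>F \<ge> 3\<close> this yields \<open>e \<le> 3 n - 6\<close>, with equality if all facets are triangles.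

  The single tool for all local statements (two edges at a vertex of a polygon, two facets at an
  edge, two facets crossing a level at a vertex) is \<open>slice_facets_bij\<close>: in general
  position, the facets of a hyperplane section are the sections of the facets that the hyperplane
  crosses. It lowers the dimension until the section is a segment with its two endpoints.
\<close>

section \<open>Faces and vertices of polytopes\<close>

abbreviation vertices :: "'a::euclidean_space set \<Rightarrow> 'a set" where
  "vertices P \<equiv> {v. v extreme_point_of P}"

lemma polytope_eq_hull_vertices: "polytope P \<Longrightarrow> P = convex hull (vertices P)"
  by (simp add: Krein_Milman_Minkowski polytope_imp_compact polytope_imp_convex)

lemma finite_vertices: "polytope P \<Longrightarrow> finite (vertices P)"
  by (simp add: finite_polyhedron_extreme_points polytope_imp_polyhedron)

lemma vertices_face: "F face_of P \<Longrightarrow> vertices F = {v \<in> vertices P. v \<in> F}"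
  by (auto simp: extreme_point_of_face)

lemma vertices_subset: "vertices P \<subseteq> P"
  by (auto simp: extreme_point_of_def)

lemma polytope_slice:
  fixes P :: "'a::euclidean_space set"
  shows "polytope P \<Longrightarrow> polytope (P \<inter> {x. c \<bullet> x = h})"
  by (simp add: polytope_Int_polyhedron polyhedron_hyperplane)

lemma polytope_subset_halfspace:
  assumes "polytope P" "convex H" "vertices P \<subseteq> H"
  shows "P \<subseteq> H"
  by (metis assms hull_minimal polytope_eq_hull_vertices)

lemma aff_dim_le_card_vertices:
  assumes "polytope P"
  shows "aff_dim P \<le> int (card (vertices P)) - 1"
proof -
  have "aff_dim P = aff_dim (vertices P)"
    by (metis assms polytope_eq_hull_vertices aff_dim_convex_hull)
  then show ?thesis
    using aff_dim_le_card[OF finite_vertices[OF assms]] by simp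
qed

lemma polytope_segment:
  fixes P :: "'a::euclidean_space set"
  assumes "polytope P" "aff_dim P = 1"
  obtains a b where "P = closed_segment a b" "a \<noteq> b" "vertices P = {a, b}"
proof -
  have "P \<noteq> {}" using assms(2) by auto
  then obtain a b where ab: "P = closed_segment a b"
    using assms compact_convex_collinear_segment[of P]
    by (auto simp: collinear_aff_dim polytope_imp_compact polytope_imp_convex)
  moreover have "a \<noteq> b" using ab assms(2) by auto
  moreover have "vertices P = {a, b}"
    using ab by (auto simp: extreme_point_of_segment)
  ultimately show ?thesis using that by blast
qed

section \<open>Hyperplane sections\<close>

text \<open>
  Crossing is demanded strictly on both sides, so that touching a face does not count. This makes
  the section of a crossed convex set meet its relative interior.
\<close>

definition crosses :: "'a::euclidean_space \<Rightarrow> real \<Rightarrow> 'a set \<Rightarrow> bool" where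
  "crosses c h F \<longleftrightarrow> (\<exists>p\<in>F. c \<bullet> p < h) \<and> (\<exists>q\<in>F. h < c \<bullet> q)"

lemma crosses_mono: "crosses c h F \<Longrightarrow> F \<subseteq> G \<Longrightarrow> crosses c h G"
  by (auto simp: crosses_def)

text \<open>
  The relative interior is dense and the open half-spaces are open.
\<close>

lemma crosses_rel_interior:
  assumes "convex F" "crosses c h F"
  shows "crosses c h (rel_interior F)"
proof -
  have "\<exists>x\<in>rel_interior F. x \<in> U" if "open U" "p \<in> U" "p \<in> F" for U p
  proof -
    have "p \<in> closure (rel_interior F)"
      using convex_closure_rel_interior[OF assms(1)] that(3) closure_subset by blast
    then show ?thesis
      using that by (meson closure_iff_nhds_not_empty[THEN iffD1] disjoint_iff subset_refl)
  qed
  from this[OF open_halfspace_lt[of c h]] this[OF open_halfspace_gt[of h c]] show ?thesis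
    using assms(2) unfolding crosses_def by blast
qed

lemma convex_crosses_meets_hyperplane:
  assumes "convex F" "crosses c h F"
  obtains x where "x \<in> F" "c \<bullet> x = h"
proof -
  obtain p q where pq: "p \<in> F" "c \<bullet> p < h" "q \<in> F" "h < c \<bullet> q"
    using assms(2) by (auto simp: crosses_def)
  obtain z where "z \<in> F" "c \<bullet> z = h"
    using connected_ivt_hyperplane[of F p q c h] pq convex_connected[OF assms(1)] by force
  then show ?thesis using that by blast
qed

lemma rel_interior_meets_hyperplane:
  assumes "convex F" "crosses c h F"
  obtains x where "x \<in> rel_interior F" "c \<bullet> x = h"
  using convex_crosses_meets_hyperplane[OF convex_rel_interior crosses_rel_interior] assms by blast

text \<open>
  Near a relative interior point on the hyperplane, the section looks like a neighbourhood in
  \<open>affine hull F \<inter> {x. c \<bullet> x = h}\<close>, so it spans this affine space.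
\<close>

lemma aff_dim_slice:
  fixes F :: "'a::euclidean_space set"
  assumes "convex F" "crosses c h F"
  shows "aff_dim (F \<inter> {x. c \<bullet> x = h}) = aff_dim F - 1"
proof -
  let ?H = "{x. c \<bullet> x = h}"
  obtain x where x: "x \<in> rel_interior F" "c \<bullet> x = h"
    using rel_interior_meets_hyperplane[OF assms] .
  have "convex (affine hull F \<inter> ?H)"
    by (simp add: convex_Int convex_hyperplane)
  moreover obtain U where U: "open U" "rel_interior F = affine hull F \<inter> U"
    using openin_rel_interior[of F] by (auto simp: openin_open)
  moreover have "(affine hull F \<inter> ?H) \<inter> U \<noteq> {}"
    using x U by blast
  ultimately have "affine hull ((affine hull F \<inter> ?H) \<inter> U) = affine hull (affine hull F \<inter> ?H)"
    by (intro affine_hull_convex_Int_open)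
  moreover have "(affine hull F \<inter> ?H) \<inter> U = rel_interior F \<inter> ?H"
    using U by blast
  ultimately have "affine hull (affine hull F \<inter> ?H) = affine hull (rel_interior F \<inter> ?H)"
    by simp
  then have "aff_dim (affine hull F \<inter> ?H) \<le> aff_dim (F \<inter> ?H)"
    by (metis aff_dim_affine_hull aff_dim_subset Int_mono order_refl rel_interior_subset)
  moreover have "aff_dim (F \<inter> ?H) \<le> aff_dim (affine hull F \<inter> ?H)"
    by (meson Int_mono aff_dim_subset hull_subset order_refl)
  moreover have "aff_dim (affine hull F \<inter> ?H) = aff_dim F - 1"
  proof -
    have "\<not> affine hull F \<subseteq> ?H"
      using assms(2) hull_subset[of F affine] by (force simp: crosses_def)
    moreover have "affine hull F \<inter> ?H \<noteq> {}"
      using x rel_interior_subset hull_subset[of F affine] by blast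
    ultimately show ?thesis
      by (simp add: aff_dim_affine_Int_hyperplane)
  qed
  ultimately show ?thesis by linarith
qed

text \<open>
  A facet of the section lies in the relative boundary of \<open>P\<close>, hence inside one facet \<open>F\<close>, and
  by dimension it is all of \<open>F \<inter> {x. c \<bullet> x = h}\<close>. If \<open>F\<close> stayed on one side of the hyperplane, this would be
  a face of \<open>P\<close> of codimension two inside the hyperplane; the genericity assumption excludes exactly
  that. The assignment is injective because the section of a crossed facet contains a relative
  interior point of it, which no other facet contains.
\<close>

lemma slice_facets_bij:
  fixes P :: "'a::euclidean_space set"
  assumes P: "polytope P" "crosses c h P"
    and generic: "\<And>R. R face_of P \<Longrightarrow> aff_dim R = aff_dim P - 2 \<Longrightarrow> R \<subseteq> {x. c \<bullet> x = h} \<Longrightarrow> R = {}"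
  shows "bij_betw (\<lambda>F. F \<inter> {x. c \<bullet> x = h}) {F. F facet_of P \<and> crosses c h F} {X. X facet_of (P \<inter> {x. c \<bullet> x = h})}"
proof -
  let ?H = "{x. c \<bullet> x = h}"
  have convH: "convex ?H" by (simp add: convex_hyperplane)
  have convP: "convex P" using P polytope_imp_convex by blast
  have dimS: "aff_dim (P \<inter> ?H) = aff_dim P - 1"
    using aff_dim_slice[OF convP P(2)] by simp
  have convF: "convex F" if "F facet_of P" for F
    using that facet_of_imp_face_of face_of_imp_convex by blast
  obtain x0 where x0: "x0 \<in> rel_interior P" "x0 \<in> ?H"
    using rel_interior_meets_hyperplane[OF convP P(2)] by auto
  have rel_S: "rel_interior (P \<inter> ?H) = rel_interior P \<inter> ?H"
    using convex_affine_rel_interior_Int[of P ?H] x0 convP by (auto simp: affine_hyperplane)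
  have into: "F \<inter> ?H facet_of (P \<inter> ?H)" if F: "F facet_of P" "crosses c h F" for F
  proof -
    have "(F \<inter> ?H) face_of (P \<inter> ?H)"
      using F facet_of_imp_face_of face_of_slice convH by blast
    moreover have "F \<inter> ?H \<noteq> {}"
      using convex_crosses_meets_hyperplane[OF convF[OF F(1)] F(2)] by auto
    moreover have "aff_dim (F \<inter> ?H) = aff_dim (P \<inter> ?H) - 1"
      using aff_dim_slice[OF convF[OF F(1)] F(2)] F(1) dimS by (simp add: facet_of_def)
    ultimately show ?thesis by (simp add: facet_of_def)
  qed
  \<comment> \<open>A face that contains a relative interior point of \<open>F\<close> contains \<open>F\<close>.\<close>
  have mono: "F \<subseteq> G"
    if F: "F facet_of P" "crosses c h F" and G: "G facet_of P" and FG: "F \<inter> ?H \<subseteq> G" for F G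
  proof -
    obtain x where "x \<in> rel_interior F" "x \<in> ?H"
      using rel_interior_meets_hyperplane[OF convF[OF F(1)] F(2)] by auto
    then have "G \<inter> rel_interior F \<noteq> {}"
      using FG rel_interior_subset by blast
    then show ?thesis
      using subset_of_face_of[of G P F] F(1) G facet_of_imp_face_of facet_of_imp_subset by blast
  qed
  have onto: "\<exists>F. F facet_of P \<and> crosses c h F \<and> X = F \<inter> ?H" if X: "X facet_of (P \<inter> ?H)" for X
  proof -
    have X_face: "X face_of (P \<inter> ?H)" and X_sub: "X \<subseteq> P \<inter> ?H"
      and X_dim: "aff_dim X = aff_dim P - 2"
      using X dimS facet_of_imp_subset[OF X] by (auto simp: facet_of_def)
    have "X \<noteq> {}" using X by (auto simp: facet_of_def)
    then obtain x where x: "x \<in> rel_interior X"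
      using X_face face_of_imp_convex rel_interior_eq_empty by blast
    have "x \<notin> rel_interior P"
    proof
      assume "x \<in> rel_interior P"
      then have "x \<in> rel_interior (P \<inter> ?H)"
        using rel_S x X_sub rel_interior_subset by blast
      then have "P \<inter> ?H \<subseteq> X"
        using subset_of_face_of[OF X_face, of "P \<inter> ?H"] x rel_interior_subset by blast
      then show False using X X_sub by auto
    qed
    moreover have "x \<in> P" using x X_sub rel_interior_subset by blast
    ultimately obtain F where F: "F facet_of P" "x \<in> F"
      using rel_boundary_of_polyhedron[OF polytope_imp_polyhedron[OF P(1)]] by blast
    have F_face: "F face_of P" using F by (simp add: facet_of_imp_face_of)
    have "X \<subseteq> F"
      using subset_of_face_of[OF F_face, of X] x F X_sub by blast
    have FH_face: "(F \<inter> ?H) face_of (P \<inter> ?H)"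
      using F_face convH face_of_slice by blast
    have "x0 \<notin> F"
      using face_of_disjoint_rel_interior[of F P] F F_face x0 by fastforce
    then have "F \<inter> ?H \<noteq> P \<inter> ?H"
      using x0 rel_interior_subset by blast
    then have FH_dim: "aff_dim (F \<inter> ?H) < aff_dim P - 1"
      using face_of_aff_dim_lt[OF _ FH_face] convP convH dimS by (simp add: convex_Int)
    have "X face_of (F \<inter> ?H)"
      using face_of_subset[OF X_face, of "F \<inter> ?H"] \<open>X \<subseteq> F\<close> X_sub FH_face face_of_imp_subset by blast
    then have XF: "X = F \<inter> ?H"
      using face_of_aff_dim_lt[of "F \<inter> ?H" X] FH_dim X_dim FH_face face_of_imp_convex
      by fastforce
    have "crosses c h F"
    proof (rule ccontr)
      assume "\<not> ?thesis"
      then have "(\<forall>p\<in>F. h \<le> c \<bullet> p) \<or> (\<forall>p\<in>F. c \<bullet> p \<le> h)"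
        by (force simp: crosses_def)
      then have "(F \<inter> ?H) face_of F"
        using face_of_Int_supporting_hyperplane_le[OF convF[OF F(1)], of c h]
          face_of_Int_supporting_hyperplane_ge[OF convF[OF F(1)], of h c]
        by auto
      then have "X face_of P" using XF F_face face_of_trans by blast
      then show False using generic X_dim X_sub \<open>X \<noteq> {}\<close> by blast
    qed
    then show ?thesis using F XF by blast
  qed
  show ?thesis
    unfolding bij_betw_def
  proof
    show "inj_on (\<lambda>F. F \<inter> ?H) {F. F facet_of P \<and> crosses c h F}"
    proof (rule inj_onI)
      fix F G
      assume FG: "F \<in> {F. F facet_of P \<and> crosses c h F}" "G \<in> {F. F facet_of P \<and> crosses c h F}"
        "F \<inter> ?H = G \<inter> ?H"
      then have F: "F facet_of P" "crosses c h F" and G: "G facet_of P" "crosses c h G" by simp_all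
      show "F = G"
        using mono[OF F G(1)] mono[OF G F(1)] FG(3) by blast
    qed
    show "(\<lambda>F. F \<inter> ?H) ` {F. F facet_of P \<and> crosses c h F} = {X. X facet_of (P \<inter> ?H)}"
      using into onto by blast
  qed
qed

text \<open>
  The same bijection, localized at a point \<open>m\<close> of the hyperplane: this is how facets around a face
  of \<open>P\<close> are counted as facets around a face of one dimension less.
\<close>

lemma card_facets_through_slice:
  fixes P :: "'a::euclidean_space set"
  assumes P: "polytope P" "crosses c (c \<bullet> m) P"
    and generic: "\<And>R. R face_of P \<Longrightarrow> aff_dim R = aff_dim P - 2 \<Longrightarrow> R \<subseteq> {x. c \<bullet> x = c \<bullet> m} \<Longrightarrow> R = {}"
  shows "card {F. F facet_of P \<and> crosses c (c \<bullet> m) F \<and> m \<in> F} =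
         card {X. X facet_of (P \<inter> {x. c \<bullet> x = c \<bullet> m}) \<and> m \<in> X}"
proof -
  let ?H = "{x. c \<bullet> x = c \<bullet> m}"
  have b: "bij_betw (\<lambda>F. F \<inter> ?H) {F. F facet_of P \<and> crosses c (c \<bullet> m) F} {X. X facet_of (P \<inter> ?H)}"
    using slice_facets_bij[OF P generic] by blast
  have "bij_betw (\<lambda>F. F \<inter> ?H) {F. F facet_of P \<and> crosses c (c \<bullet> m) F \<and> m \<in> F}
      {X. X facet_of (P \<inter> ?H) \<and> m \<in> X}"
    by (rule bij_betw_subset[OF b]) (use bij_betw_imp_surj_on[OF b] in auto)
  then show ?thesis by (rule bij_betw_same_card)
qed

section \<open>Polygons\<close>

lemma card_facets_segment:
  fixes P :: "'a::euclidean_space set"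
  assumes "polytope P" "aff_dim P = 1"
  shows "card {F. F facet_of P} = 2"
proof -
  obtain a b where ab: "P = closed_segment a b" "a \<noteq> b" "vertices P = {a, b}"
    using polytope_segment[OF assms] .
  have "{F. F facet_of P} = (\<lambda>v. {v}) ` vertices P"
    using assms(2) by (auto simp: facet_of_def aff_dim_eq_0 face_of_singleton[symmetric])
  then show ?thesis using ab by simp
qed

text \<open>
  A line that separates \<open>v\<close> from the other vertices cuts the polygon in a segment, whose two
  endpoints are the traces of the edges at \<open>v\<close>.
\<close>

lemma card_polygon_edges_at_vertex:
  fixes P :: "'a::euclidean_space set"
  assumes P: "polytope P" "aff_dim P = 2" and v: "v \<in> vertices P"
  shows "card {F. F facet_of P \<and> v \<in> F} = 2"
proof -
  let ?W = "convex hull (vertices P - {v})"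
  have "?W \<subseteq> P - {v}"
    using v P(1) vertices_subset[of P]
    by (intro hull_minimal) (auto simp: extreme_point_of_stillconvex polytope_imp_convex)
  then have "v \<notin> ?W" by blast
  moreover have "closed ?W"
    by (simp add: finite_vertices P(1) finite_imp_compact_convex_hull compact_imp_closed)
  ultimately obtain c h where ch: "c \<bullet> v < h" "\<And>x. x \<in> ?W \<Longrightarrow> h < c \<bullet> x"
    using separating_hyperplane_closed_point[OF convex_convex_hull] by blast
  \<comment> \<open>Hence the line cuts exactly those faces of positive dimension that contain \<open>v\<close>.\<close>
  have cross_iff: "crosses c h F \<longleftrightarrow> v \<in> F" if F: "F face_of P" "1 \<le> aff_dim F" for F
  proof
    have pF: "polytope F" using F P(1) face_of_polytope_polytope by blast
    show "v \<in> F" if "crosses c h F"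
    proof (rule ccontr)
      assume "v \<notin> F"
      then have "vertices F \<subseteq> vertices P - {v}" using vertices_face[OF F(1)] by blast
      then have "F \<subseteq> ?W" using polytope_eq_hull_vertices[OF pF] hull_mono by metis
      then show False using that ch by (force simp: crosses_def)
    qed
    show "crosses c h F" if "v \<in> F"
    proof -
      have "2 \<le> card (vertices F)"
        using aff_dim_le_card_vertices[OF pF] F(2) by linarith
      then obtain w where "w \<in> vertices F" "w \<noteq> v"
        by (metis card_le_Suc0_iff_eq finite_vertices[OF pF] not_less_eq_eq numeral_2_eq_2)
      then have "w \<in> F" "w \<in> ?W"
        using vertices_face[OF F(1)] by (auto intro: hull_inc)
      then show ?thesis using ch \<open>v \<in> F\<close> by (auto simp: crosses_def)
    qed
  qed
  let ?S = "P \<inter> {x. c \<bullet> x = h}"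
  have crP: "crosses c h P"
    using cross_iff[of P] P v vertices_subset by (auto simp: face_of_refl polytope_imp_convex)
  have generic: "R = {}" if "R face_of P" "aff_dim R = aff_dim P - 2" "R \<subseteq> {x. c \<bullet> x = h}" for R
  proof -
    have "aff_dim R = 0" using that P(2) by simp
    then obtain r where r: "R = {r}" using aff_dim_eq_0 by blast
    then have "r \<in> vertices P" using that by (simp add: face_of_singleton)
    then have "c \<bullet> r \<noteq> h" using ch hull_inc[of r "vertices P - {v}" convex] by fastforce
    then show ?thesis using that r by auto
  qed
  have "bij_betw (\<lambda>F. F \<inter> {x. c \<bullet> x = h}) {F. F facet_of P \<and> crosses c h F} {X. X facet_of ?S}"
    by (rule slice_facets_bij[OF P(1) crP generic])
  then have "card {F. F facet_of P \<and> crosses c h F} = card {X. X facet_of ?S}"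
    by (rule bij_betw_same_card)
  also have "\<dots> = 2"
    using aff_dim_slice[OF polytope_imp_convex[OF P(1)] crP] P
    by (intro card_facets_segment) (auto simp: polytope_slice)
  also have "{F. F facet_of P \<and> crosses c h F} = {F. F facet_of P \<and> v \<in> F}"
    using cross_iff P(2) by (auto simp: facet_of_def)
  finally show ?thesis .
qed

lemma card_polygon_edges:
  fixes P :: "'a::euclidean_space set"
  assumes P: "polytope P" "aff_dim P = 2"
  shows "card {F. F facet_of P} = card (vertices P)"
proof -
  let ?F = "{F. F facet_of P}"
  have "(\<Sum>F\<in>?F. card {v \<in> vertices P. v \<in> F}) = 2 * card (vertices P)"
    by (rule sum_multicount)
      (use card_polygon_edges_at_vertex[OF P] in \<open>auto simp: finite_vertices finite_polytope_facets P\<close>)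
  moreover have "card {v \<in> vertices P. v \<in> F} = 2" if "F \<in> ?F" for F
  proof -
    have F: "F face_of P" "aff_dim F = 1" using that P(2) by (auto simp: facet_of_def)
    obtain a b where "a \<noteq> b" "vertices F = {a, b}"
      using polytope_segment[of F] F face_of_polytope_polytope[OF P(1)] by blast
    then show ?thesis using vertices_face[OF F(1)] by simp
  qed
  ultimately show ?thesis by simp
qed

section \<open>Facets around edges and vertices of a three-dimensional polytope\<close>

text \<open>
  The functionals that identify two given points form a hyperplane, and finitely many hyperplanes do
  not cover the space.
\<close>

lemma exists_inj_functional:
  fixes V :: "'a::euclidean_space set"
  assumes "finite V"
  obtains c where "inj_on (\<lambda>x. c \<bullet> x) V"
proof -
  let ?bad = "\<Union>(x, y)\<in>V \<times> V - Id. {c. (x - y) \<bullet> c = 0}"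
  have "negligible ?bad"
    using assms by (intro negligible_Union) (auto intro!: negligible_hyperplane)
  then have "?bad \<noteq> UNIV" using non_negligible_UNIV by metis
  then obtain c where c: "c \<notin> ?bad" by blast
  have "inj_on (\<lambda>x. c \<bullet> x) V"
  proof (rule inj_onI, rule ccontr)
    fix x y assume "x \<in> V" "y \<in> V" "c \<bullet> x = c \<bullet> y" "x \<noteq> y"
    then have "(x, y) \<in> V \<times> V - Id" "(x - y) \<bullet> c = 0"
      by (simp, metis inner_commute inner_diff_left right_minus_eq)
    then show False using c by blast
  qed
  then show ?thesis using that by blast
qed

text \<open>
  A plane through an inner point \<open>m\<close> of the edge that separates its ends and avoids all vertices
  cuts \<open>P\<close> in a polygon having \<open>m\<close> as a vertex; the facets containing the edge leave the polygon
  edges at \<open>m\<close>.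
\<close>

lemma card_facets_through_edge:
  fixes P :: "'a::euclidean_space set"
  assumes P: "polytope P" "aff_dim P = 3" and e: "e edge_of P"
  shows "card {F. F facet_of P \<and> e \<subseteq> F} = 2"
proof -
  have e_face: "e face_of P" "aff_dim e = 1" using e by (auto simp: edge_of_def)
  have pe: "polytope e" using P e_face face_of_polytope_polytope by blast
  obtain a b where ab: "e = closed_segment a b" "a \<noteq> b" "vertices e = {a, b}"
    using polytope_segment[OF pe e_face(2)] .
  have finV: "finite (vertices P)" by (simp add: finite_vertices P)
  obtain c where inj: "inj_on (\<lambda>x. c \<bullet> x) (vertices P)"
    using exists_inj_functional[OF finV] .
  have "a \<in> vertices P" "b \<in> vertices P" using ab vertices_face[OF e_face(1)] by auto
  then have "c \<bullet> a \<noteq> c \<bullet> b" using inj ab(2) by (auto dest: inj_onD)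
  then obtain u w where uw: "e = closed_segment u w" "c \<bullet> u < c \<bullet> w"
    by (metis ab(1) closed_segment_commute linorder_neqE_linordered_idom)
  \<comment> \<open>A level strictly between the ends of \<open>e\<close> that avoids the finitely many levels of vertices.\<close>
  have "infinite ({c \<bullet> u<..<c \<bullet> w} - (\<lambda>x. c \<bullet> x) ` vertices P)"
    using finV uw by (intro Diff_infinite_finite) auto
  then obtain h where h: "c \<bullet> u < h" "h < c \<bullet> w" "h \<notin> (\<lambda>x. c \<bullet> x) ` vertices P"
    by (metis DiffE ex_in_conv finite.emptyI greaterThanLessThan_iff)
  have cre: "crosses c h e" using uw h by (auto simp: crosses_def)
  then obtain m where m: "m \<in> e" "c \<bullet> m = h"
    using convex_crosses_meets_hyperplane face_of_imp_convex[OF e_face(1)] by blast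
  let ?S = "P \<inter> {x. c \<bullet> x = c \<bullet> m}"
  have crP: "crosses c (c \<bullet> m) P"
    using crosses_mono[OF cre face_of_imp_subset[OF e_face(1)]] m by simp
  have "aff_dim (e \<inter> {x. c \<bullet> x = c \<bullet> m}) = 0"
    using aff_dim_slice[OF face_of_imp_convex[OF e_face(1)] cre] m e_face by simp
  then obtain m' where "e \<inter> {x. c \<bullet> x = c \<bullet> m} = {m'}" using aff_dim_eq_0 by blast
  then have em: "e \<inter> {x. c \<bullet> x = c \<bullet> m} = {m}" using m(1) by auto
  then have "{m} face_of ?S"
    using face_of_slice[OF e_face(1) convex_hyperplane, of c "c \<bullet> m"] by simp
  then have mS: "m \<in> vertices ?S" by (simp add: face_of_singleton)
  have generic: "R = {}" if R: "R face_of P" "aff_dim R = aff_dim P - 2" "R \<subseteq> {x. c \<bullet> x = c \<bullet> m}" for R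
  proof -
    have "aff_dim R = 1" using R P by simp
    then obtain r s where "R = closed_segment r s" "vertices R = {r, s}"
      using polytope_segment[OF face_of_polytope_polytope[OF P(1) R(1)]] by metis
    then have r: "r \<in> vertices P" "r \<in> R" using vertices_face[OF R(1)] by auto
    have "h = c \<bullet> r" using subsetD[OF R(3) r(2)] m(2) by simp
    then have "h \<in> (\<lambda>x. c \<bullet> x) ` vertices P" using r(1) by (rule image_eqI)
    with h(3) show ?thesis by contradiction
  qed
  have "card {F. F facet_of P \<and> crosses c (c \<bullet> m) F \<and> m \<in> F} = card {X. X facet_of ?S \<and> m \<in> X}"
    by (rule card_facets_through_slice[OF P(1) crP generic])
  also have "\<dots> = 2"
    using aff_dim_slice[OF polytope_imp_convex[OF P(1)] crP] P mS
    by (intro card_polygon_edges_at_vertex) (auto simp: polytope_slice)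
  also have "{F. F facet_of P \<and> crosses c (c \<bullet> m) F \<and> m \<in> F} = {F. F facet_of P \<and> e \<subseteq> F}"
  proof -
    have "m \<in> open_segment u w"
      using m uw h by (auto simp: open_segment_def)
    moreover have "u \<in> P" "w \<in> P" using uw e_face face_of_imp_subset by auto
    ultimately have "e \<subseteq> F" if "F face_of P" "m \<in> F" for F
      using face_ofD[OF that(1), of m u w] that uw face_of_imp_convex[OF that(1)]
      by (simp add: closed_segment_subset)
    moreover have "crosses c (c \<bullet> m) F" if "e \<subseteq> F" for F
      using crosses_mono[OF cre that] m by simp
    ultimately show ?thesis using m facet_of_imp_face_of by blast
  qed
  finally show ?thesis .
qed

text \<open>
  The local statement of the sweep. The plane at the level of \<open>v\<close> contains no edge of \<open>P\<close>, as the
  ends of an edge have different levels, so it is in general position although it passes through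
  a vertex.
\<close>

lemma card_crossing_facets_at_vertex:
  fixes P :: "'a::euclidean_space set"
  assumes P: "polytope P" "aff_dim P = 3" and inj: "inj_on (\<lambda>x. c \<bullet> x) (vertices P)"
    and v: "v \<in> vertices P" and cr: "crosses c (c \<bullet> v) P"
  shows "card {F. F facet_of P \<and> crosses c (c \<bullet> v) F \<and> v \<in> F} = 2"
proof -
  let ?S = "P \<inter> {x. c \<bullet> x = c \<bullet> v}"
  have generic: "R = {}" if R: "R face_of P" "aff_dim R = aff_dim P - 2" "R \<subseteq> {x. c \<bullet> x = c \<bullet> v}" for R
  proof -
    have dimR: "aff_dim R = 1" using R P by simp
    have polyR: "polytope R" using face_of_polytope_polytope[OF P(1) R(1)] .
    obtain a b where ab: "R = closed_segment a b" "a \<noteq> b" "vertices R = {a, b}"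
      using polytope_segment[OF polyR dimR] .
    have "a \<in> vertices P" "b \<in> vertices P"
      using ab(3) vertices_face[OF R(1)] by auto
    moreover have "a \<in> {x. c \<bullet> x = c \<bullet> v}" "b \<in> {x. c \<bullet> x = c \<bullet> v}"
      by (rule subsetD[OF R(3)], simp add: ab(1))+
    then have "c \<bullet> a = c \<bullet> b" by simp
    ultimately show ?thesis using inj_onD[OF inj] ab(2) by blast
  qed
  have "card {F. F facet_of P \<and> crosses c (c \<bullet> v) F \<and> v \<in> F} = card {X. X facet_of ?S \<and> v \<in> X}"
    by (rule card_facets_through_slice[OF P(1) cr generic])
  also have "{v} face_of ?S"
    using face_of_slice[of "{v}" P "{x. c \<bullet> x = c \<bullet> v}"] v by (simp add: face_of_singleton convex_hyperplane)
  then have "card {X. X facet_of ?S \<and> v \<in> X} = 2"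
    using aff_dim_slice[OF polytope_imp_convex[OF P(1)] cr] P
    by (intro card_polygon_edges_at_vertex) (auto simp: polytope_slice face_of_singleton)
  finally show ?thesis .
qed

section \<open>Counting edges of polytopes\<close>

text \<open>
  All vertices are strictly between bottom and top except the unique lowest and the unique highest
  one. This is applied both to a polytope and to its facets.
\<close>

lemma card_vertices_crossed:
  fixes P :: "'a::euclidean_space set"
  assumes P: "polytope P" "2 \<le> card (vertices P)" and inj: "inj_on (\<lambda>x. c \<bullet> x) (vertices P)"
  shows "card {v \<in> vertices P. crosses c (c \<bullet> v) P} = card (vertices P) - 2"
proof -
  let ?V = "vertices P" and ?f = "\<lambda>x. c \<bullet> x"
  have fin: "finite ?V" by (simp add: finite_vertices P)
  have ne: "?V \<noteq> {}" using P(2) by (metis card.empty not_numeral_le_zero)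
  obtain t where t: "t \<in> ?V" "\<And>v. v \<in> ?V \<Longrightarrow> ?f v \<le> ?f t"
    using ex_is_arg_min_if_finite[OF fin ne, of "\<lambda>x. - ?f x"] by (auto simp: is_arg_min_linorder)
  obtain b where b: "b \<in> ?V" "\<And>v. v \<in> ?V \<Longrightarrow> ?f b \<le> ?f v"
    using ex_is_arg_min_if_finite[OF fin ne, of ?f] by (auto simp: is_arg_min_linorder)
  have "t \<noteq> b"
  proof
    assume "t = b"
    then have "v = t" if "v \<in> ?V" for v
      using inj_onD[OF inj, of v t] that t b by force
    then have "?V \<subseteq> {t}" by blast
    then show False using card_mono[of "{t}" ?V] P(2) by simp
  qed
  have up: "?f x \<le> ?f t" if "x \<in> P" for x
    using polytope_subset_halfspace[OF P(1) convex_halfspace_le, of c "?f t"] t that by auto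
  have lo: "?f b \<le> ?f x" if "x \<in> P" for x
    using polytope_subset_halfspace[OF P(1) convex_halfspace_ge, of "?f b" c] b that by auto
  have "{v \<in> ?V. crosses c (c \<bullet> v) P} = ?V - {t, b}"
  proof (intro equalityI subsetI)
    fix v assume "v \<in> {v \<in> ?V. crosses c (c \<bullet> v) P}"
    then show "v \<in> ?V - {t, b}" using up lo by (force simp: crosses_def)
  next
    fix v assume v: "v \<in> ?V - {t, b}"
    then have "?f v \<noteq> ?f t" "?f v \<noteq> ?f b" using inj_onD[OF inj] t b by blast+
    then have "?f b < ?f v" "?f v < ?f t" using v t b by fastforce+
    then show "v \<in> {v \<in> ?V. crosses c (c \<bullet> v) P}"
      using t b v vertices_subset[of P] by (auto simp: crosses_def)
  qed
  then show ?thesis using fin t b \<open>t \<noteq> b\<close> by simp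
qed

text \<open>
  Euler's formula in the form of two double counts, of pairs of an edge and a facet and of pairs of
  a vertex and a facet that is crossed at the level of this vertex. With \<open>f\<close> facets, subtracting the two
  equations gives \<open>f = e - n + 2\<close>.
\<close>

lemma polytope_3_counts:
  fixes P :: "'a::euclidean_space set"
  assumes P: "polytope P" "aff_dim P = 3"
  shows "(\<Sum>F | F facet_of P. card (vertices F)) = 2 * card {e. e edge_of P}"
    and "(\<Sum>F | F facet_of P. card (vertices F) - 2) = 2 * (card (vertices P) - 2)"
    and "\<And>F. F facet_of P \<Longrightarrow> 3 \<le> card (vertices F)"
proof -
  let ?F = "{F. F facet_of P}" and ?E = "{e. e edge_of P}"
  have finF: "finite ?F" by (simp add: finite_polytope_facets P)
  have finE: "finite ?E"
    using finite_polytope_faces[OF P(1)] by (rule rev_finite_subset) (auto simp: edge_of_def)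
  have F: "F face_of P" "polytope F" "aff_dim F = 2" if "F facet_of P" for F
    using that P face_of_polytope_polytope by (auto simp: facet_of_def)
  show ge3: "3 \<le> card (vertices F)" if "F facet_of P" for F
    using aff_dim_le_card_vertices[of F] F[OF that] by linarith
  have "card {e \<in> ?E. e \<subseteq> F} = card (vertices F)" if "F \<in> ?F" for F
  proof -
    have f: "F facet_of P" using that by simp
    have "e edge_of P \<and> e \<subseteq> F \<longleftrightarrow> e facet_of F" for e
      using face_of_face[OF F(1)[OF f], of e] F(3)[OF f] by (auto simp: facet_of_def edge_of_def)
    then show ?thesis using card_polygon_edges[OF F(2)[OF f] F(3)[OF f]] by simp
  qed
  then have "(\<Sum>F\<in>?F. card (vertices F)) = (\<Sum>F\<in>?F. card {e \<in> ?E. e \<subseteq> F})" by simp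
  also have "\<dots> = 2 * card ?E"
    by (rule sum_multicount) (use finF finE card_facets_through_edge[OF P] in auto)
  finally show "(\<Sum>F\<in>?F. card (vertices F)) = 2 * card ?E" .
  obtain c where inj: "inj_on (\<lambda>x. c \<bullet> x) (vertices P)"
    using exists_inj_functional[OF finite_vertices[OF P(1)]] .
  \<comment> \<open>The vertices other than the lowest and the highest one.\<close>
  let ?T = "{v \<in> vertices P. crosses c (c \<bullet> v) P}"
  have "card {v \<in> ?T. v \<in> F \<and> crosses c (c \<bullet> v) F} = card (vertices F) - 2" if "F \<in> ?F" for F
  proof -
    have "crosses c (c \<bullet> v) P" if "crosses c (c \<bullet> v) F" for v
      using crosses_mono[OF that facet_of_imp_subset] \<open>F \<in> ?F\<close> by simp
    then have "{v \<in> ?T. v \<in> F \<and> crosses c (c \<bullet> v) F} = {v \<in> vertices F. crosses c (c \<bullet> v) F}"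
      using vertices_face[OF F(1), of F] that by auto
    moreover have "inj_on (\<lambda>x. c \<bullet> x) (vertices F)"
      using inj by (rule inj_on_subset) (use vertices_face[OF F(1), of F] that in auto)
    ultimately show ?thesis
      using card_vertices_crossed[of F c] F ge3[of F] that by simp
  qed
  then have "(\<Sum>F\<in>?F. card (vertices F) - 2) = (\<Sum>F\<in>?F. card {v \<in> ?T. v \<in> F \<and> crosses c (c \<bullet> v) F})"
    by simp
  also have "\<dots> = 2 * card ?T"
  proof (rule sum_multicount)
    show "\<forall>v\<in>?T. card {F \<in> ?F. v \<in> F \<and> crosses c (c \<bullet> v) F} = 2"
      using card_crossing_facets_at_vertex[OF P inj] by (auto simp: conj_commute)
  qed (use finF finite_vertices[OF P(1)] in auto)
  also have "card ?T = card (vertices P) - 2"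
    using aff_dim_le_card_vertices[OF P(1)] P(2) by (intro card_vertices_crossed[OF P(1) _ inj]) linarith
  finally show "(\<Sum>F\<in>?F. card (vertices F) - 2) = 2 * (card (vertices P) - 2)" .
qed

lemma polytope_3_card_edges_le:
  fixes P :: "'a::euclidean_space set"
  assumes P: "polytope P" "aff_dim P = 3"
  shows "card {e. e edge_of P} \<le> 3 * card (vertices P) - 6"
proof -
  have "2 * card {e. e edge_of P} = (\<Sum>F | F facet_of P. card (vertices F))"
    by (simp add: polytope_3_counts(1)[OF P])
  also have "\<dots> \<le> (\<Sum>F | F facet_of P. 3 * (card (vertices F) - 2))"
    by (rule sum_mono) (use polytope_3_counts(3)[OF P] in fastforce)
  also have "\<dots> = 6 * (card (vertices P) - 2)"
    by (simp add: sum_distrib_left[symmetric] polytope_3_counts(2)[OF P])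
  finally show ?thesis by simp
qed

lemma simplicial_3_polytope_card_edges:
  assumes "simplicial_3_polytope P"
  shows "card {e. e edge_of P} = 3 * card (vertices P) - 6"
proof -
  have P: "polytope P" "aff_dim P = 3"
    and simplices: "\<forall>F. F face_of P \<and> F \<noteq> P \<longrightarrow> (\<exists>n. n simplex F)"
    using assms unfolding simplicial_3_polytope_def by simp_all
  have "card (vertices F) = 3" if F: "F facet_of P" for F
  proof -
    have "F face_of P" "F \<noteq> P" using F facet_of_imp_face_of by auto
    then obtain n where "n simplex F" using simplices by metis
    then have "2 simplex F" using aff_dim_simplex[of n F] F P by (simp add: facet_of_def)
    then obtain C where C: "\<not> affine_dependent C" "int (card C) = 2 + 1" "F = convex hull C"
      unfolding simplex_def by blast
    then have "vertices F = C" by (simp add: extreme_point_of_convex_hull_affine_independent)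
    then show ?thesis using C by simp
  qed
  then have "(\<Sum>F | F facet_of P. card (vertices F)) = (\<Sum>F | F facet_of P. 3 * (card (vertices F) - 2))"
    by simp
  also have "\<dots> = 6 * (card (vertices P) - 2)"
    by (simp add: sum_distrib_left[symmetric] polytope_3_counts(2)[OF P])
  finally show ?thesis using polytope_3_counts(1)[OF P] by simp
qed

text \<open>
  The edges of \<open>P\<close> spanned by \<open>A\<close> survive as edges of \<open>convex hull A\<close>, whose vertices are exactly \<open>A\<close>.
  This hull may be flat, in which case it is a polygon, but three vertices of \<open>P\<close> are
  never collinear.
\<close>

lemma card_edges_spanned_le:
  fixes P :: "'a::euclidean_space set"
  assumes P: "polytope P" "aff_dim P = 3" and A: "A \<subseteq> vertices P" "3 \<le> card A"
  shows "card {e. e edge_of P \<and> vertices e \<subseteq> A} \<le> 3 * card A - 6"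
proof -
  let ?Q = "convex hull A"
  have finA: "finite A" using A(1) finite_vertices[OF P(1)] finite_subset by blast
  then have Q: "polytope ?Q" by (simp add: polytope_convex_hull)
  have QP: "?Q \<subseteq> P"
    using A(1) vertices_subset[of P] polytope_imp_convex[OF P(1)] by (intro hull_minimal) auto
  have vQ: "vertices ?Q = A"
  proof
    show "vertices ?Q \<subseteq> A" using extreme_point_of_convex_hull by blast
    have "{a} face_of ?Q" if "a \<in> A" for a
      by (rule face_of_subset[of _ P]) (use that A(1) QP in \<open>auto simp: face_of_singleton hull_inc\<close>)
    then show "A \<subseteq> vertices ?Q" by (auto simp: face_of_singleton)
  qed
  have finE: "finite {e. e edge_of ?Q}"
    using finite_polytope_faces[OF Q] by (rule rev_finite_subset) (auto simp: edge_of_def)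
  have "{e. e edge_of P \<and> vertices e \<subseteq> A} \<subseteq> {e. e edge_of ?Q}"
  proof safe
    fix e assume e: "e edge_of P" "vertices e \<subseteq> A"
    have "polytope e" using e(1) P(1) face_of_polytope_polytope by (auto simp: edge_of_def)
    then have "e \<subseteq> ?Q" using e(2) hull_mono polytope_eq_hull_vertices by metis
    then show "e edge_of ?Q" using e(1) QP face_of_subset by (auto simp: edge_of_def)
  qed
  then have "card {e. e edge_of P \<and> vertices e \<subseteq> A} \<le> card {e. e edge_of ?Q}"
    using finE card_mono by blast
  also have "\<dots> \<le> 3 * card A - 6"
  proof -
    \<comment> \<open>Otherwise \<open>?Q\<close> is a simplex with at most two vertices.\<close>
    have "\<not> aff_dim ?Q \<le> 1"
    proof
      assume "aff_dim ?Q \<le> 1"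
      then obtain n where n: "n simplex ?Q" using polytope_lowdim_imp_simplex[OF Q] by blast
      then obtain C where C: "\<not> affine_dependent C" "int (card C) = n + 1" "?Q = convex hull C"
        unfolding simplex_def by blast
      then have "vertices ?Q = C" by (simp add: extreme_point_of_convex_hull_affine_independent)
      then show False using vQ A(2) C(2) aff_dim_simplex[OF n] \<open>aff_dim ?Q \<le> 1\<close> by simp
    qed
    moreover have "aff_dim ?Q \<le> 3" using aff_dim_subset[OF QP] P(2) by simp
    ultimately consider "aff_dim ?Q = 2" | "aff_dim ?Q = 3" by linarith
    then show ?thesis
    proof cases
      case 1
      then have "{e. e edge_of ?Q} = {F. F facet_of ?Q}"
        by (auto simp: edge_of_def facet_of_def)
      then show ?thesis using card_polygon_edges[OF Q 1] vQ A(2) by simp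
    next
      case 2
      then show ?thesis using polytope_3_card_edges_le[OF Q] vQ by simp
    qed
  qed
  finally show ?thesis .
qed

section \<open>Minimum cuts in sparse graphs\<close>

text \<open>
  The edges are abstract, with \<open>ends\<close> assigning to each the set of its two endpoints, so that arcs of
  a plane drawing can be used as edges directly. The set in the last assumption is the cut
  between \<open>A\<close> and \<open>B\<close>; its minimality enters as the comparison with the stars of vertices.
\<close>

lemma min_cut_trivial_graph:
  fixes ends :: "'e \<Rightarrow> 'v set"
  assumes fin: "finite V" "finite E" and V4: "4 \<le> card V"
    and ends: "\<And>e. e \<in> E \<Longrightarrow> ends e \<subseteq> V \<and> card (ends e) = 2" "inj_on ends E"
    and total: "card E = 3 * card V - 6"
    and sub: "\<And>A. A \<subseteq> V \<Longrightarrow> 3 \<le> card A \<Longrightarrow> card {e \<in> E. ends e \<subseteq> A} \<le> 3 * card A - 6"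
    and AB: "A \<union> B = V" "A \<inter> B = {}" "A \<noteq> {}" "B \<noteq> {}"
    and min: "\<And>v. v \<in> V \<Longrightarrow> card {e \<in> E. \<not> ends e \<subseteq> A \<and> \<not> ends e \<subseteq> B} \<le> card {e \<in> E. v \<in> ends e}"
  shows "\<exists>v. A = {v} \<or> B = {v}"
proof (rule ccontr)
  assume no: "\<not> ?thesis"
  define d where "d v = card {e \<in> E. v \<in> ends e}" for v
  define k where "k = card {e \<in> E. \<not> ends e \<subseteq> A \<and> \<not> ends e \<subseteq> B}"
  have k_le: "k \<le> d v" if "v \<in> V" for v
    using min[OF that] by (simp add: k_def d_def)
  have finAB: "finite A" "finite B" "A \<subseteq> V" "B \<subseteq> V"
    using fin AB by (auto intro: finite_subset)
  have cardV: "card V = card A + card B"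
    using AB finAB by (metis card_Un_disjoint)
  have big: "2 \<le> card A" "2 \<le> card B"
  proof -
    have "card A \<noteq> 0" "card A \<noteq> 1" "card B \<noteq> 0" "card B \<noteq> 1"
      using no AB finAB by (auto simp: card_1_singleton_iff)
    then show "2 \<le> card A" "2 \<le> card B" by linarith+
  qed
  \<comment> \<open>Compare the total number of edges with the bound for the vertices other than \<open>v\<close>.\<close>
  have d3: "3 \<le> d v" if v: "v \<in> V" for v
  proof -
    have "E = {e \<in> E. ends e \<subseteq> V - {v}} \<union> {e \<in> E. v \<in> ends e}"
      using ends by auto
    then have "card E \<le> card {e \<in> E. ends e \<subseteq> V - {v}} + d v"
      unfolding d_def by (metis (lifting) card_Un_le)
    moreover have "card (V - {v}) = card V - 1" using v fin by simp
    then have "card {e \<in> E. ends e \<subseteq> V - {v}} \<le> 3 * (card V - 1) - 6"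
      using sub[of "V - {v}"] V4 by fastforce
    ultimately show ?thesis using total V4 by linarith
  qed
  have k5: "k \<le> 5"
  proof (rule ccontr)
    assume "\<not> k \<le> 5"
    then have "6 \<le> d v" if "v \<in> V" for v using k_le[OF that] by linarith
    then have "6 * card V \<le> (\<Sum>v\<in>V. d v)"
      using sum_bounded_below[of V 6 d] by simp
    also have "(\<Sum>v\<in>V. d v) = 2 * card E"
      unfolding d_def
    proof (rule sum_multicount)
      have "{v \<in> V. v \<in> ends e} = ends e" if "e \<in> E" for e using ends that by auto
      then show "\<forall>e\<in>E. card {v \<in> V. v \<in> ends e} = 2" using ends by simp
    qed (use fin in auto)
    finally show False using total V4 by linarith
  qed
  \<comment> \<open>A side with two vertices: the two stars together contain at most \<open>k\<close> cut edges and, twice, the edge joining them.\<close>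
  have small: False if ab: "card S = 2" "S \<subseteq> V" "card {e \<in> E. ends e \<inter> S \<noteq> {} \<and> \<not> ends e \<subseteq> S} \<le> k" for S
  proof -
    obtain u w where S: "S = {u, w}" "u \<noteq> w"
      using ab by (auto simp: card_2_iff)
    let ?U = "{e \<in> E. u \<in> ends e}" and ?W = "{e \<in> E. w \<in> ends e}"
    let ?C = "{e \<in> E. ends e \<inter> S \<noteq> {} \<and> \<not> ends e \<subseteq> S}" and ?I = "{e \<in> E. ends e = S}"
    have eq: "ends e = S" if "e \<in> E" "u \<in> ends e" "w \<in> ends e" for e
      using ends(1)[OF that(1)] that S by (auto simp: card_2_iff)
    have "card ?I \<le> card {S}"
      by (rule card_inj_on_le[of ends]) (use ends(2) in \<open>auto simp: inj_on_def\<close>)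
    then have I: "card ?I \<le> 1" by simp
    have "d u + d w = card (?U \<union> ?W) + card (?U \<inter> ?W)"
      unfolding d_def by (rule card_Un_Int) (use fin in auto)
    also have "card (?U \<inter> ?W) \<le> card ?I"
      by (rule card_mono) (use fin eq in auto)
    also have "card (?U \<union> ?W) \<le> card (?C \<union> ?I)"
    proof (rule card_mono)
      have "ends e = S" if "e \<in> E" "ends e \<subseteq> S" for e
        using ends(1)[OF that(1)] that S card_seteq[of S "ends e"] by auto
      then show "?U \<union> ?W \<subseteq> ?C \<union> ?I" using S by blast
    qed (use fin in auto)
    also have "card (?C \<union> ?I) \<le> card ?C + card ?I" by (rule card_Un_le)
    finally have "d u + d w \<le> k + 2" using ab I by linarith
    then show False using k_le[of u] d3[of w] S ab by auto
  qed
  have cross: "{e \<in> E. ends e \<inter> A \<noteq> {} \<and> \<not> ends e \<subseteq> A} = {e \<in> E. \<not> ends e \<subseteq> A \<and> \<not> ends e \<subseteq> B}"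
    "{e \<in> E. ends e \<inter> B \<noteq> {} \<and> \<not> ends e \<subseteq> B} = {e \<in> E. \<not> ends e \<subseteq> A \<and> \<not> ends e \<subseteq> B}"
    using ends(1) AB by blast+
  have "card A \<noteq> 2" "card B \<noteq> 2"
    using small[of A] small[of B] finAB cross by (auto simp: k_def)
  then have 3: "3 \<le> card A" "3 \<le> card B" using big by linarith+
  let ?A = "{e \<in> E. ends e \<subseteq> A}" and ?B = "{e \<in> E. ends e \<subseteq> B}"
  let ?C = "{e \<in> E. \<not> ends e \<subseteq> A \<and> \<not> ends e \<subseteq> B}"
  have "card E \<le> card (?A \<union> ?B \<union> ?C)"
    by (rule card_mono) (use fin in auto)
  also have "\<dots> \<le> card ?A + card ?B + k"
    unfolding k_def by (metis (no_types, lifting) card_Un_le add_le_mono le_trans order_refl)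
  also have "\<dots> \<le> (3 * card A - 6) + (3 * card B - 6) + k"
    using sub[OF finAB(3) 3(1)] sub[OF finAB(4) 3(2)] by linarith
  finally show False using total cardV 3 k5 by linarith
qed

section \<open>Plane triangulations\<close>

text \<open>
  It remains to transfer the counts along the realization: an arc corresponds to the segment
  spanned by the images of its endpoints, which is a bijection onto the edges of the polytope.
\<close>

theorem corollary2:
  fixes V :: "complex set" and E C :: "complex set set"
  assumes "plane_triangulation V E"
    and "minimum_edge_cut V E C"
  shows "trivial_edge_cut V E C"
proof -
  obtain P where plane: "simple_plane_graph V E" and simpl: "simplicial_3_polytope P"
    and "realizes_polytope_graph V E P"
    using assms(1) by (auto simp: plane_triangulation_def)
  then obtain \<phi> where \<phi>: "bij_betw \<phi> V (vertices P) \<and>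
      (\<forall>u\<in>V. \<forall>v\<in>V. (\<exists>e\<in>E. e \<inter> V = {u, v}) \<longleftrightarrow> closed_segment (\<phi> u) (\<phi> v) edge_of P)"
    unfolding realizes_polytope_graph_def by (elim exE)
  have bij: "bij_betw \<phi> V (vertices P)" using \<phi> by (rule conjunct1)
  have edge: "(\<exists>e\<in>E. e \<inter> V = {u, v}) \<longleftrightarrow> closed_segment (\<phi> u) (\<phi> v) edge_of P"
    if "u \<in> V" "v \<in> V" for u v
    using \<phi> that by simp
  have P: "polytope P" "aff_dim P = 3" using simpl unfolding simplicial_3_polytope_def by simp_all
  have fin: "finite V" "finite E" using plane by (auto simp: simple_plane_graph_def)
  have arcs: "\<forall>e\<in>E. \<exists>g. arc g \<and> path_image g = e \<and> e \<inter> V = {pathstart g, pathfinish g}"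
    and no_parallel: "\<forall>e\<in>E. \<forall>f\<in>E. e \<noteq> f \<longrightarrow> e \<inter> f \<subseteq> V \<and> e \<inter> V \<noteq> f \<inter> V"
    using plane unfolding simple_plane_graph_def by simp_all
  have ends2: "card (e \<inter> V) = 2" if e: "e \<in> E" for e
  proof -
    obtain g where g: "arc g" "e \<inter> V = {pathstart g, pathfinish g}"
      using bspec[OF arcs e] by (elim exE conjE)
    then show ?thesis using arc_distinct_ends[OF g(1)] by simp
  qed
  have inj_ends: "inj_on (\<lambda>e. e \<inter> V) E"
  proof (rule inj_onI)
    fix e f assume "e \<in> E" "f \<in> E" "e \<inter> V = f \<inter> V"
    then show "e = f" using bspec[OF bspec[OF no_parallel], of e f] by metis
  qed
  have inj: "inj_on \<phi> V" and img: "\<phi> ` V = vertices P"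
    using bij by (auto simp: bij_betw_def)
  have cardV: "card V = card (vertices P)" using bij bij_betw_same_card by blast
  let ?\<psi> = "\<lambda>e. convex hull (\<phi> ` (e \<inter> V))"
  have hull: "\<exists>u\<in>V. \<exists>w\<in>V. u \<noteq> w \<and> e \<inter> V = {u, w} \<and> ?\<psi> e = closed_segment (\<phi> u) (\<phi> w) \<and> ?\<psi> e edge_of P
      \<and> vertices (?\<psi> e) = \<phi> ` (e \<inter> V)" if e: "e \<in> E" for e
  proof -
    obtain u w where uw: "e \<inter> V = {u, w}" "u \<noteq> w" using ends2[OF e] by (auto simp: card_2_iff)
    then have V: "u \<in> V" "w \<in> V" by blast+
    have seg: "?\<psi> e = closed_segment (\<phi> u) (\<phi> w)" using uw by (simp add: segment_convex_hull)
    moreover have "?\<psi> e edge_of P" using edge[OF V] e uw(1) seg by auto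
    moreover have "vertices (?\<psi> e) = \<phi> ` (e \<inter> V)"
      unfolding seg using uw(1) by (auto simp: extreme_point_of_segment)
    ultimately show ?thesis using uw V by blast
  qed
  have inj_\<psi>: "inj_on ?\<psi> E"
  proof (rule inj_onI)
    fix e f assume ef: "e \<in> E" "f \<in> E" "?\<psi> e = ?\<psi> f"
    then have "\<phi> ` (e \<inter> V) = \<phi> ` (f \<inter> V)" using hull[OF ef(1)] hull[OF ef(2)] by metis
    then have "e \<inter> V = f \<inter> V" using inj_on_image_eq_iff[OF inj] by simp
    then show "e = f" using inj_ends ef by (auto dest: inj_onD)
  qed
  have finP: "finite {s. s edge_of P}"
    using finite_polytope_faces[OF P(1)] by (rule rev_finite_subset) (auto simp: edge_of_def)
  have surj_\<psi>: "s \<in> ?\<psi> ` E" if s: "s edge_of P" for s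
  proof -
    have s': "s face_of P" "aff_dim s = 1" using s by (auto simp: edge_of_def)
    obtain a b where ab: "s = closed_segment a b" "a \<noteq> b" "vertices s = {a, b}"
      using polytope_segment[OF face_of_polytope_polytope[OF P(1) s'(1)] s'(2)] .
    then have "a \<in> \<phi> ` V" "b \<in> \<phi> ` V" using vertices_face[OF s'(1)] img by auto
    then obtain u w where uw: "u \<in> V" "w \<in> V" "a = \<phi> u" "b = \<phi> w" by blast
    then obtain e where e: "e \<in> E" "e \<inter> V = {u, w}" using edge[of u w] ab s by auto
    then have "?\<psi> e = s" using ab uw by (simp add: segment_convex_hull)
    then show ?thesis using e by blast
  qed
  have total: "card E = 3 * card V - 6"
  proof -
    have "?\<psi> ` E = {s. s edge_of P}" using surj_\<psi> hull by blast
    then have "card E = card {s. s edge_of P}" using card_image[OF inj_\<psi>] by simp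
    then show ?thesis using simplicial_3_polytope_card_edges[OF simpl] cardV by simp
  qed
  have sub: "card {e \<in> E. e \<inter> V \<subseteq> A} \<le> 3 * card A - 6" if A: "A \<subseteq> V" "3 \<le> card A" for A
  proof -
    have injA: "inj_on \<phi> A" using inj A inj_on_subset by blast
    have "card {e \<in> E. e \<inter> V \<subseteq> A} \<le> card {s. s edge_of P \<and> vertices s \<subseteq> \<phi> ` A}"
    proof (rule card_inj_on_le[of ?\<psi>])
      show "inj_on ?\<psi> {e \<in> E. e \<inter> V \<subseteq> A}" using inj_\<psi> by (rule inj_on_subset) auto
      show "?\<psi> ` {e \<in> E. e \<inter> V \<subseteq> A} \<subseteq> {s. s edge_of P \<and> vertices s \<subseteq> \<phi> ` A}"
      proof
        fix s assume "s \<in> ?\<psi> ` {e \<in> E. e \<inter> V \<subseteq> A}"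
        then obtain e where e: "e \<in> E" "e \<inter> V \<subseteq> A" "s = ?\<psi> e" by blast
        then have "s edge_of P" "vertices s = \<phi> ` (e \<inter> V)" using hull[OF e(1)] by auto
        then show "s \<in> {s. s edge_of P \<and> vertices s \<subseteq> \<phi> ` A}" using e(2) by auto
      qed
      show "finite {s. s edge_of P \<and> vertices s \<subseteq> \<phi> ` A}" using finP by simp
    qed
    also have "\<dots> \<le> 3 * card (\<phi> ` A) - 6"
      using A img card_image[OF injA] by (intro card_edges_spanned_le[OF P]) auto
    finally show ?thesis using card_image[OF injA] by simp
  qed
  have V4: "4 \<le> card V"
    using aff_dim_le_card_vertices[OF P(1)] P(2) cardV by linarith
  have between: "edges_between V E A B = {e \<in> E. \<not> e \<inter> V \<subseteq> A \<and> \<not> e \<inter> V \<subseteq> B}"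
    if AB: "A \<union> B = V" "A \<inter> B = {}" for A B
  proof -
    have "(\<exists>a\<in>A. \<exists>b\<in>B. e \<inter> V = {a, b}) \<longleftrightarrow> \<not> e \<inter> V \<subseteq> A \<and> \<not> e \<inter> V \<subseteq> B" if "e \<in> E" for e
    proof -
      obtain u w where "e \<inter> V = {u, w}" using ends2[OF \<open>e \<in> E\<close>] by (auto simp: card_2_iff)
      moreover have "u \<in> A \<union> B" "w \<in> A \<union> B" using calculation AB(1) by auto
      ultimately show ?thesis using AB(2) by (auto simp: doubleton_eq_iff)
    qed
    then show ?thesis by (auto simp: edges_between_def)
  qed
  have star: "edges_between V E {v} (V - {v}) = {e \<in> E. v \<in> e}" if v: "v \<in> V" for v
  proof -
    have "(\<not> e \<inter> V \<subseteq> {v} \<and> \<not> e \<inter> V \<subseteq> V - {v}) \<longleftrightarrow> v \<in> e" if "e \<in> E" for e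
    proof -
      have "\<not> e \<inter> V \<subseteq> {v}"
        using ends2[OF that] card_mono[of "{v}" "e \<inter> V"] by auto
      then show ?thesis using v by blast
    qed
    then have "{e \<in> E. \<not> e \<inter> V \<subseteq> {v} \<and> \<not> e \<inter> V \<subseteq> V - {v}} = {e \<in> E. v \<in> e}"
      by (intro Collect_cong conj_cong refl)
    moreover have "edges_between V E {v} (V - {v}) = {e \<in> E. \<not> e \<inter> V \<subseteq> {v} \<and> \<not> e \<inter> V \<subseteq> V - {v}}"
      by (rule between) (use v in blast)+
    ultimately show ?thesis by simp
  qed
  obtain A B where AB: "A \<union> B = V" "A \<inter> B = {}" "A \<noteq> {}" "B \<noteq> {}"
    and C: "C = edges_between V E A B"
    using assms(2) by (auto simp: minimum_edge_cut_def edge_cut_def)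
  have "card {e \<in> E. \<not> e \<inter> V \<subseteq> A \<and> \<not> e \<inter> V \<subseteq> B} \<le> card {e \<in> E. v \<in> e \<inter> V}" if v: "v \<in> V" for v
  proof -
    have "V - {v} \<noteq> {}" using V4 v card_mono[of "{v}" V] by auto
    then have "{v} \<union> (V - {v}) = V \<and> {v} \<inter> (V - {v}) = {} \<and> {v} \<noteq> {} \<and> V - {v} \<noteq> {} \<and>
        {e \<in> E. v \<in> e} = edges_between V E {v} (V - {v})"
      using star[OF v] v by blast
    then have "edge_cut V E {e \<in> E. v \<in> e}"
      unfolding edge_cut_def by (intro exI)
    then have "card C \<le> card {e \<in> E. v \<in> e}"
      using assms(2) by (simp add: minimum_edge_cut_def)
    then show ?thesis using C between[OF AB(1,2)] v by simp
  qed
  then have "\<exists>v. A = {v} \<or> B = {v}"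
    using min_cut_trivial_graph[of V E "\<lambda>e. e \<inter> V" A B] fin V4 ends2 inj_ends total sub AB by blast
  then obtain v where v: "A = {v} \<or> B = {v}" ..
  then have "v \<in> V" using AB by blast
  moreover have "C = {e \<in> E. v \<in> e}"
  proof -
    have "C = edges_between V E {v} (V - {v})"
      using v
    proof
      assume "A = {v}"
      moreover have "B = V - {v}" using AB \<open>A = {v}\<close> by blast
      ultimately show ?thesis using C by simp
    next
      assume "B = {v}"
      moreover have "A = V - {v}" using AB \<open>B = {v}\<close> by blast
      ultimately show ?thesis
        using C between[OF AB(1,2)] between[of "{v}" "V - {v}"] \<open>v \<in> V\<close> by auto
    qed
    then show ?thesis using star[OF \<open>v \<in> V\<close>] by simp
  qed
  ultimately show ?thesis
    using assms(2) by (auto simp: trivial_edge_cut_def minimum_edge_cut_def)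
qed

end
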